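(* Let $\lambda\in\mathbf{k}$ and let $(\mathfrak{A},[-,-,-],\mathrm{d})$ be a modified $\lambda$-differential 3-Lie algebra. If $(\mathfrak{A}[[t]],\nu_t,\mathrm{d}_t)$ and $(\mathfrak{A}[[t]],\nu'_t,\mathrm{d}'_t)$ are two equivalent linear deformations of $(\mathfrak{A},[-,-,-],\mathrm{d})$, then their infinitesimals $(\nu_1,\mathrm{d}_1)$ and $(\nu'_1,\mathrm{d}'_1)$ are in the same cohomology class in $\mathcal{H}^2_{\mathrm{md3Lie}_\lambda}(\mathfrak{A},\mathfrak{A})$ (coefficients in the adjoint representation).
   Context: Throughout, $\mathbf{k}$ is a field of characteristic zero; all vector spaces and linear maps are over $\mathbf{k}$. 3-Lie algebra: a vector space $\mathfrak{A}$ with a skew-symmetric trilinear bracket $[-,-,-]:\wedge^3\mathfrak{A}\to\mathfrak{A}$ satisfying $[a_1,a_2,[a_3,a_4,a_5]]=[[a_1,a_2,a_3],a_4,a_5]+[a_3,[a_1,a_2,a_4],a_5]+[a_3,a_4,[a_1,a_2,a_5]]$. Modified $\lambda$-differential 3-Lie algebra: a triple $(\mathfrak{A},[-,-,-],\mathrm{d})$ with $(\mathfrak{A},[-,-,-])$ a 3-Lie algebra and $\mathrm{d}:\mathfrak{A}\to\mathfrak{A}$ linear such that $\mathrm{d}[a_1,a_2,a_3]=[\mathrm{d}(a_1),a_2,a_3]+[a_1,\mathrm{d}(a_2),a_3]+[a_1,a_2,\mathrm{d}(a_3)]+\lambda[a_1,a_2,a_3]$. Linear deformation of $(\mathfrak{A},[-,-,-],\mathrm{d})$: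 a pair $(\nu_t,\mathrm{d}_t)$ with $\nu_t=\nu_0+t\nu_1+t^2\nu_2$, $\mathrm{d}_t=\mathrm{d}_0+t\mathrm{d}_1$, where $\nu_0=[-,-,-]$, $\mathrm{d}_0=\mathrm{d}$, $\nu_1,\nu_2\in\mathrm{Hom}(\wedge^3\mathfrak{A},\mathfrak{A})$, $\mathrm{d}_1\in\mathrm{Hom}(\mathfrak{A},\mathfrak{A})$, such that $(\mathfrak{A}[[t]],\nu_t,\mathrm{d}_t)$ (maps extended $\mathbf{k}[[t]]$-multilinearly) is a modified $\lambda$-differential 3-Lie algebra. The pair $(\nu_1,\mathrm{d}_1)$ is called the infinitesimal of the deformation; it is a 2-cocycle (defined below). Two linear deformations $(\nu_t,\mathrm{d}_t)$ and $(\nu'_t,\mathrm{d}'_t)$ are equivalent if there is a linear map $N:\mathfrak{A}\to\mathfrak{A}$ such that $N_t=\mathrm{id}_{\mathfrak{A}}+tN$ satisfies $N_t(\mathrm{d}_t(a_1))=\mathrm{d}'_t(N_t(a_1))$ and $N_t\nu_t(a_1,a_2,a_3)=\nu'_t(N_t(a_1),N_t(a_2),N_t(a_3))$ for all $a_1,a_2,a_3\in\mathfrak{A}$. Second cohomology with coefficients in the adjoint representation: write $\rho(a,b)c=[a,b,c]$. For $g\in\mathrm{Hom}(\mathfrak{A},\mathfrak{A})$ put $(\delta g)(a_1,a_2,a_3)=\rho(a_2,a_3)g(a_1)+\rho(a_3,a_1)g(a_2)+\rho(a_1,a_2)g(a_3)-g([a_1,a_2,a_3])$ and $(\Phi g)(a)=g(\mathrm{d}(a))-\mathrm{d}(g(a))$.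 For $f\in\mathrm{Hom}(\wedge^3\mathfrak{A},\mathfrak{A})$ put $(\delta f)(a_1,\dots,a_5)=-\rho(a_4,a_5)f(a_1,a_2,a_3)-\rho(a_5,a_3)f(a_1,a_2,a_4)+\rho(a_1,a_2)f(a_3,a_4,a_5)-\rho(a_3,a_4)f(a_1,a_2,a_5)-f(a_3,a_4,[a_1,a_2,a_5])+f(a_1,a_2,[a_3,a_4,a_5])-f([a_1,a_2,a_3],a_4,a_5)-f(a_3,[a_1,a_2,a_4],a_5)$ and $(\Phi f)(a_1,a_2,a_3)=f(\mathrm{d}(a_1),a_2,a_3)+f(a_1,\mathrm{d}(a_2),a_3)+f(a_1,a_2,\mathrm{d}(a_3))+\lambda f(a_1,a_2,a_3)-\mathrm{d}(f(a_1,a_2,a_3))$. A 2-cocycle is a pair $(f,g)\in\mathrm{Hom}(\wedge^3\mathfrak{A},\mathfrak{A})\oplus\mathrm{Hom}(\mathfrak{A},\mathfrak{A})$ with $\delta f=0$ and $\delta g+\Phi f=0$; a 2-coboundary is a pair $(\delta h,-\Phi h)$ with $h\in\mathrm{Hom}(\mathfrak{A},\mathfrak{A})$; $\mathcal{H}^2_{\mathrm{md3Lie}_\lambda}(\mathfrak{A},\mathfrak{A})$ is the quotient of 2-cocycles by 2-coboundaries. *)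

theory Defs
  imports
    "HOL-Computational_Algebra.Formal_Power_Series"
    "HOL-Library.Function_Algebras"
    "HOL-Library.Product_Plus"
begin

unbundle fps_syntax

section \<open>Modified differential 3-Lie algebras\<close>

text \<open>
  The algebraic notions are stated for modules over a commutative ring, because they are needed
  both over the ground field \<open>k\<close> and over \<open>k[[t]]\<close>. Over a field, the axioms
  of \<^locale>\<open>module\<close> and of \<^locale>\<open>vector_space\<close> coincide.
\<close>

definition Hom1 :: "('r::comm_ring_1 \<Rightarrow> 'm::ab_group_add \<Rightarrow> 'm) \<Rightarrow> ('m \<Rightarrow> 'm) set" where
  "Hom1 scale = {g. module_hom scale scale g}"

text \<open>
  Linear maps out of the third exterior power are represented as skew-symmetric trilinear maps
  (2 is invertible wherever this is used). The two transpositions generate all permutations.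
\<close>

definition Hom3 ::
  "('r::comm_ring_1 \<Rightarrow> 'm::ab_group_add \<Rightarrow> 'm) \<Rightarrow> ('m \<Rightarrow> 'm \<Rightarrow> 'm \<Rightarrow> 'm) set" where
  "Hom3 scale = {f.
     (\<forall>b c. module_hom scale scale (\<lambda>a. f a b c)) \<and>
     (\<forall>a c. module_hom scale scale (\<lambda>b. f a b c)) \<and>
     (\<forall>a b. module_hom scale scale (\<lambda>c. f a b c)) \<and>
     (\<forall>a b c. f b a c = - f a b c) \<and>
     (\<forall>a b c. f a c b = - f a b c)}"

locale three_Lie_algebra = module scale
  for scale :: "'r::comm_ring_1 \<Rightarrow> 'm::ab_group_add \<Rightarrow> 'm" +
  fixes br :: "'m \<Rightarrow> 'm \<Rightarrow> 'm \<Rightarrow> 'm"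
  assumes br_Hom3: "br \<in> Hom3 scale"
    and fundamental_identity:
      "br a1 a2 (br a3 a4 a5) =
         br (br a1 a2 a3) a4 a5 + br a3 (br a1 a2 a4) a5 + br a3 a4 (br a1 a2 a5)"

locale modified_differential_three_Lie_algebra = three_Lie_algebra scale br
  for scale :: "'r::comm_ring_1 \<Rightarrow> 'm::ab_group_add \<Rightarrow> 'm"
    and br :: "'m \<Rightarrow> 'm \<Rightarrow> 'm \<Rightarrow> 'm" +
  fixes lam :: 'r and d :: "'m \<Rightarrow> 'm"
  assumes d_Hom1: "d \<in> Hom1 scale"
    and modified_Leibniz:
      "d (br a1 a2 a3) =
         br (d a1) a2 a3 + br a1 (d a2) a3 + br a1 a2 (d a3) + scale lam (br a1 a2 a3)"

section \<open>Linear deformations\<close>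

text \<open>
  The \<open>k[[t]]\<close>-module of formal power series with coefficients in a vector space is
  the type \<^typ>\<open>'m fps\<close>, with \<^const>\<open>fps_X\<close> in the role of \<open>t\<close> and
  \<^const>\<open>fps_const\<close> embedding the vector space.
\<close>

definition fps_scale :: "('k::comm_ring_1 \<Rightarrow> 'm::ab_group_add \<Rightarrow> 'm) \<Rightarrow> 'k fps \<Rightarrow> 'm fps \<Rightarrow> 'm fps" where
  "fps_scale scale c x = Abs_fps (\<lambda>n. \<Sum>i\<le>n. scale (c $ i) (x $ (n - i)))"

text \<open>The coefficientwise (t-adically continuous) multilinear extensions to power series.\<close>

definition fps_ext1 :: "('m::ab_group_add \<Rightarrow> 'm) \<Rightarrow> 'm fps \<Rightarrow> 'm fps" where
  "fps_ext1 g x = Abs_fps (\<lambda>n. g (x $ n))"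

definition fps_ext3 ::
  "('m::ab_group_add \<Rightarrow> 'm \<Rightarrow> 'm \<Rightarrow> 'm) \<Rightarrow> 'm fps \<Rightarrow> 'm fps \<Rightarrow> 'm fps \<Rightarrow> 'm fps" where
  "fps_ext3 f x y z =
     Abs_fps (\<lambda>n. \<Sum>i\<le>n. \<Sum>j\<le>n - i. f (x $ i) (y $ j) (z $ (n - i - j)))"

definition deformed_map ::
  "('k::comm_ring_1 \<Rightarrow> 'm::ab_group_add \<Rightarrow> 'm) \<Rightarrow> ('m \<Rightarrow> 'm) \<Rightarrow> ('m \<Rightarrow> 'm) \<Rightarrow> 'm fps \<Rightarrow> 'm fps" where
  "deformed_map scale g0 g1 x = fps_ext1 g0 x + fps_scale scale fps_X (fps_ext1 g1 x)"

definition deformed_bracket ::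
  "('k::comm_ring_1 \<Rightarrow> 'm::ab_group_add \<Rightarrow> 'm) \<Rightarrow>
   ('m \<Rightarrow> 'm \<Rightarrow> 'm \<Rightarrow> 'm) \<Rightarrow> ('m \<Rightarrow> 'm \<Rightarrow> 'm \<Rightarrow> 'm) \<Rightarrow> ('m \<Rightarrow> 'm \<Rightarrow> 'm \<Rightarrow> 'm) \<Rightarrow>
   'm fps \<Rightarrow> 'm fps \<Rightarrow> 'm fps \<Rightarrow> 'm fps" where
  "deformed_bracket scale nu0 nu1 nu2 x y z =
     fps_ext3 nu0 x y z
     + fps_scale scale fps_X (fps_ext3 nu1 x y z)
     + fps_scale scale (fps_X ^ 2) (fps_ext3 nu2 x y z)"

definition linear_deformation ::
  "('k::field_char_0 \<Rightarrow> 'm::ab_group_add \<Rightarrow> 'm) \<Rightarrow> ('m \<Rightarrow> 'm \<Rightarrow> 'm \<Rightarrow> 'm) \<Rightarrow> 'k \<Rightarrow> ('m \<Rightarrow> 'm) \<Rightarrow>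
   ('m \<Rightarrow> 'm \<Rightarrow> 'm \<Rightarrow> 'm) \<Rightarrow> ('m \<Rightarrow> 'm \<Rightarrow> 'm \<Rightarrow> 'm) \<Rightarrow> ('m \<Rightarrow> 'm) \<Rightarrow> bool" where
  "linear_deformation scale br lam d nu1 nu2 d1 \<longleftrightarrow>
     nu1 \<in> Hom3 scale \<and> nu2 \<in> Hom3 scale \<and> d1 \<in> Hom1 scale \<and>
     modified_differential_three_Lie_algebra (fps_scale scale)
       (deformed_bracket scale br nu1 nu2) (fps_const lam) (deformed_map scale d d1)"

definition equivalent_deformations ::
  "('k::field_char_0 \<Rightarrow> 'm::ab_group_add \<Rightarrow> 'm) \<Rightarrow>
   ('m fps \<Rightarrow> 'm fps \<Rightarrow> 'm fps \<Rightarrow> 'm fps) \<Rightarrow> ('m fps \<Rightarrow> 'm fps) \<Rightarrow>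
   ('m fps \<Rightarrow> 'm fps \<Rightarrow> 'm fps \<Rightarrow> 'm fps) \<Rightarrow> ('m fps \<Rightarrow> 'm fps) \<Rightarrow> bool" where
  "equivalent_deformations scale nut dt nut' dt' \<longleftrightarrow>
     (\<exists>N \<in> Hom1 scale. let Nt = deformed_map scale id N in
        (\<forall>a1. Nt (dt (fps_const a1)) = dt' (Nt (fps_const a1))) \<and>
        (\<forall>a1 a2 a3. Nt (nut (fps_const a1) (fps_const a2) (fps_const a3)) =
           nut' (Nt (fps_const a1)) (Nt (fps_const a2)) (Nt (fps_const a3))))"

section \<open>Second cohomology with coefficients in the adjoint representation\<close>

text \<open>
  Zero, sums and differences of cochains are pointwise, and componentwise on pairs. The adjoint
  representation sends \<open>a\<close>, \<open>b\<close>, \<open>c\<close> to \<open>br a b c\<close>.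
\<close>

definition delta1 ::
  "('m::ab_group_add \<Rightarrow> 'm \<Rightarrow> 'm \<Rightarrow> 'm) \<Rightarrow> ('m \<Rightarrow> 'm) \<Rightarrow> 'm \<Rightarrow> 'm \<Rightarrow> 'm \<Rightarrow> 'm" where
  "delta1 br g a1 a2 a3 = br a2 a3 (g a1) + br a3 a1 (g a2) + br a1 a2 (g a3) - g (br a1 a2 a3)"

definition Phi1 :: "('m::ab_group_add \<Rightarrow> 'm) \<Rightarrow> ('m \<Rightarrow> 'm) \<Rightarrow> 'm \<Rightarrow> 'm" where
  "Phi1 d g a = g (d a) - d (g a)"

definition delta3 ::
  "('m::ab_group_add \<Rightarrow> 'm \<Rightarrow> 'm \<Rightarrow> 'm) \<Rightarrow> ('m \<Rightarrow> 'm \<Rightarrow> 'm \<Rightarrow> 'm) \<Rightarrow>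
   'm \<Rightarrow> 'm \<Rightarrow> 'm \<Rightarrow> 'm \<Rightarrow> 'm \<Rightarrow> 'm" where
  "delta3 br f a1 a2 a3 a4 a5 =
     - br a4 a5 (f a1 a2 a3) - br a5 a3 (f a1 a2 a4) + br a1 a2 (f a3 a4 a5) - br a3 a4 (f a1 a2 a5)
     - f a3 a4 (br a1 a2 a5) + f a1 a2 (br a3 a4 a5) - f (br a1 a2 a3) a4 a5 - f a3 (br a1 a2 a4) a5"

definition Phi3 ::
  "('k::comm_ring_1 \<Rightarrow> 'm::ab_group_add \<Rightarrow> 'm) \<Rightarrow> 'k \<Rightarrow> ('m \<Rightarrow> 'm) \<Rightarrow>
   ('m \<Rightarrow> 'm \<Rightarrow> 'm \<Rightarrow> 'm) \<Rightarrow> 'm \<Rightarrow> 'm \<Rightarrow> 'm \<Rightarrow> 'm" where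
  "Phi3 scale lam d f a1 a2 a3 =
     f (d a1) a2 a3 + f a1 (d a2) a3 + f a1 a2 (d a3) + scale lam (f a1 a2 a3) - d (f a1 a2 a3)"

definition cocycles2 ::
  "('k::comm_ring_1 \<Rightarrow> 'm::ab_group_add \<Rightarrow> 'm) \<Rightarrow> ('m \<Rightarrow> 'm \<Rightarrow> 'm \<Rightarrow> 'm) \<Rightarrow> 'k \<Rightarrow> ('m \<Rightarrow> 'm) \<Rightarrow>
   (('m \<Rightarrow> 'm \<Rightarrow> 'm \<Rightarrow> 'm) \<times> ('m \<Rightarrow> 'm)) set" where
  "cocycles2 scale br lam d =
     {(f, g). f \<in> Hom3 scale \<and> g \<in> Hom1 scale \<and>
        delta3 br f = 0 \<and> delta1 br g + Phi3 scale lam d f = 0}"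

definition coboundaries2 ::
  "('k::comm_ring_1 \<Rightarrow> 'm::ab_group_add \<Rightarrow> 'm) \<Rightarrow> ('m \<Rightarrow> 'm \<Rightarrow> 'm \<Rightarrow> 'm) \<Rightarrow> ('m \<Rightarrow> 'm) \<Rightarrow>
   (('m \<Rightarrow> 'm \<Rightarrow> 'm \<Rightarrow> 'm) \<times> ('m \<Rightarrow> 'm)) set" where
  "coboundaries2 scale br d = {(delta1 br h, - Phi1 d h) | h. h \<in> Hom1 scale}"

definition cohomologous2 ::
  "('k::comm_ring_1 \<Rightarrow> 'm::ab_group_add \<Rightarrow> 'm) \<Rightarrow> ('m \<Rightarrow> 'm \<Rightarrow> 'm \<Rightarrow> 'm) \<Rightarrow> 'k \<Rightarrow> ('m \<Rightarrow> 'm) \<Rightarrow>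
   (('m \<Rightarrow> 'm \<Rightarrow> 'm \<Rightarrow> 'm) \<times> ('m \<Rightarrow> 'm)) rel" where
  "cohomologous2 scale br lam d =
     {(z, w). z \<in> cocycles2 scale br lam d \<and> w \<in> cocycles2 scale br lam d \<and>
        z - w \<in> coboundaries2 scale br d}"

definition cohomology2 ::
  "('k::comm_ring_1 \<Rightarrow> 'm::ab_group_add \<Rightarrow> 'm) \<Rightarrow> ('m \<Rightarrow> 'm \<Rightarrow> 'm \<Rightarrow> 'm) \<Rightarrow> 'k \<Rightarrow> ('m \<Rightarrow> 'm) \<Rightarrow>
   (('m \<Rightarrow> 'm \<Rightarrow> 'm \<Rightarrow> 'm) \<times> ('m \<Rightarrow> 'm)) set set" where
  "cohomology2 scale br lam d = cocycles2 scale br lam d // cohomologous2 scale br lam d"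

section \<open>Well-definedness\<close>

lemma (in module) module_fps_scale: "module (fps_scale scale)"
proof
  fix a b :: "'a fps" and x y :: "'b fps"
  show "fps_scale scale a (x + y) = fps_scale scale a x + fps_scale scale a y"
    by (simp add: fps_scale_def fps_eq_iff scale_right_distrib sum.distrib)
  show "fps_scale scale (a + b) x = fps_scale scale a x + fps_scale scale b x"
    by (simp add: fps_scale_def fps_eq_iff scale_left_distrib sum.distrib)
  show "fps_scale scale 1 x = x"
  proof (rule fps_ext)
    fix n
    have "fps_scale scale 1 x $ n = (\<Sum>i\<le>n. if i = 0 then x $ n else 0)"
      unfolding fps_scale_def fps_nth_Abs_fps by (rule sum.cong) auto
    then show "fps_scale scale 1 x $ n = x $ n" by simp
  qed
  show "fps_scale scale a (fps_scale scale b x) = fps_scale scale (a * b) x"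
  proof (rule fps_ext)
    fix n
    have "fps_scale scale a (fps_scale scale b x) $ n =
        (\<Sum>i\<le>n. \<Sum>j\<le>n - i. scale (a $ i * b $ j) (x $ (n - (i + j))))"
      by (simp add: fps_scale_def scale_sum_right)
    also have "\<dots> = (\<Sum>(i, j)\<in>{(i, j). i + j \<le> n}. scale (a $ i * b $ j) (x $ (n - (i + j))))"
      by (subst sum.Sigma) (auto intro!: sum.cong)
    also have "\<dots> = (\<Sum>m\<le>n. \<Sum>i\<le>m. scale (a $ i * b $ (m - i)) (x $ (n - m)))"
      by (subst sum.triangle_reindex_eq) (rule sum.cong[OF refl], rule sum.cong[OF refl], simp)
    also have "\<dots> = fps_scale scale (a * b) x $ n"
      by (simp add: fps_scale_def fps_mult_nth scale_sum_left atLeast0AtMost)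
    finally show "fps_scale scale a (fps_scale scale b x) $ n = fps_scale scale (a * b) x $ n" .
  qed
qed

lemma (in modified_differential_three_Lie_algebra) equiv_cohomologous2:
  "equiv (cocycles2 scale br lam d) (cohomologous2 scale br lam d)"
proof -
  let ?Z = "cocycles2 scale br lam d" and ?B = "coboundaries2 scale br d"
    and ?R = "cohomologous2 scale br lam d"
  have mp: "module_pair scale scale"
    by (intro module_pair.intro module_axioms)
  have br3: "module_hom scale scale (\<lambda>c. br a b c)" for a b
    using br_Hom3 unfolding Hom3_def by blast
  have dh: "module_hom scale scale d"
    using d_Hom1 by (simp add: Hom1_def)
  note hom_simps = module_hom.add[OF br3] module_hom.diff[OF br3] module_hom.zero[OF br3]
    module_hom.add[OF dh] module_hom.diff[OF dh] module_hom.zero[OF dh]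
  have zero: "0 \<in> ?B"
  proof -
    have "delta1 br (\<lambda>_. 0) = 0" "- Phi1 d (\<lambda>_. 0) = 0"
      by (simp_all add: delta1_def Phi1_def fun_eq_iff hom_simps)
    moreover have "(\<lambda>_. 0) \<in> Hom1 scale"
      by (simp add: Hom1_def module_pair.module_hom_zero[OF mp])
    ultimately show ?thesis
      unfolding coboundaries2_def zero_prod_def by fastforce
  qed
  have diff: "u - v \<in> ?B" if "u \<in> ?B" "v \<in> ?B" for u v
  proof -
    from that obtain h k where h: "h \<in> Hom1 scale" "u = (delta1 br h, - Phi1 d h)"
      and k: "k \<in> Hom1 scale" "v = (delta1 br k, - Phi1 d k)"
      unfolding coboundaries2_def by blast
    have "delta1 br h - delta1 br k = delta1 br (\<lambda>x. h x - k x)"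
      "- Phi1 d h - - Phi1 d k = - Phi1 d (\<lambda>x. h x - k x)"
      by (simp_all add: delta1_def Phi1_def fun_eq_iff hom_simps)
    moreover have "(\<lambda>x. h x - k x) \<in> Hom1 scale"
      using h(1) k(1) by (simp add: Hom1_def module_pair.module_hom_sub[OF mp])
    ultimately show ?thesis
      unfolding h(2) k(2) coboundaries2_def by auto
  qed
  have R_iff: "(z, w) \<in> ?R \<longleftrightarrow> z \<in> ?Z \<and> w \<in> ?Z \<and> z - w \<in> ?B" for z w
    by (simp add: cohomologous2_def)
  show ?thesis
  proof (rule equivI)
    show "?R \<subseteq> ?Z \<times> ?Z"
      unfolding cohomologous2_def by blast
    show "refl_on ?Z ?R"
      by (rule refl_onI) (simp add: R_iff zero)
    show "sym ?R"
    proof (rule symI)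
      fix z w assume "(z, w) \<in> ?R"
      then show "(w, z) \<in> ?R"
        using diff[OF zero, of "z - w"] by (simp only: R_iff) simp
    qed
    show "trans ?R"
    proof (rule transI)
      fix x y w assume xy: "(x, y) \<in> ?R" and yw: "(y, w) \<in> ?R"
      have "(x - y) - (0 - (y - w)) \<in> ?B"
        by (rule diff, (use xy R_iff in blast), rule diff[OF zero], use yw R_iff in blast)
      then show "(x, w) \<in> ?R"
        using xy yw by (simp only: R_iff) simp
    qed
  qed
qed

end

theory Submission
  imports Defs
begin

text \<open>
  Each identity over \<open>k[[t]]\<close>, evaluated at constant power series, is compared at order
  \<open>t\<close>. The fundamental identity and the Leibniz rule then say that the infinitesimals are
  cocycles, and the two equivalence conditions say that they differ by the coboundary of \<open>N\<close>.
\<close>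

text \<open>Comparing composites at order \<open>t\<close> requires both lowest coefficients of the
  inner map, since the outer one reads degrees 0 and 1 of its argument.\<close>

lemma (in module) deformed_map_nth_0:
  "deformed_map scale g0 g1 x $ 0 = g0 (x $ 0)"
  by (simp add: deformed_map_def fps_scale_def fps_ext1_def)

lemma (in module) deformed_map_nth_1:
  "deformed_map scale g0 g1 x $ Suc 0 = g0 (x $ Suc 0) + g1 (x $ 0)"
  by (simp add: deformed_map_def fps_scale_def fps_ext1_def)

lemma (in module) deformed_bracket_nth_0:
  "deformed_bracket scale f0 f1 f2 x y z $ 0 = f0 (x $ 0) (y $ 0) (z $ 0)"
  by (simp add: deformed_bracket_def fps_scale_def fps_ext3_def)

text \<open>The single factor \<open>t\<close> comes either from one argument of \<open>f0\<close>
  or from the coefficient in front of \<open>f1\<close>; \<open>f2\<close> carries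
  \<open>t^2\<close> and starts only one order later.\<close>

lemma (in module) deformed_bracket_nth_1:
  "deformed_bracket scale f0 f1 f2 x y z $ Suc 0 =
     f0 (x $ Suc 0) (y $ 0) (z $ 0) + f0 (x $ 0) (y $ Suc 0) (z $ 0)
     + f0 (x $ 0) (y $ 0) (z $ Suc 0) + f1 (x $ 0) (y $ 0) (z $ 0)"
  by (simp add: deformed_bracket_def fps_scale_def fps_ext3_def power2_eq_square algebra_simps)

lemma (in module) fps_scale_const_nth:
  "fps_scale scale (fps_const c) x $ n = scale c (x $ n)"
proof -
  have "fps_scale scale (fps_const c) x $ n = (\<Sum>i\<le>n. if i = 0 then scale c (x $ n) else 0)"
    unfolding fps_scale_def fps_nth_Abs_fps by (rule sum.cong) auto
  then show ?thesis by simp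
qed

lemmas (in module) deformed_nth = deformed_map_nth_0 deformed_map_nth_1
  deformed_bracket_nth_0 deformed_bracket_nth_1 fps_scale_const_nth

lemma Hom1_zero: "g \<in> Hom1 scale \<Longrightarrow> g 0 = 0"
  by (simp add: Hom1_def module_hom.zero)

text \<open>Linearity in each slot. A constant series has coefficient 0 at \<open>t\<close>, so this
  removes the terms in which that coefficient fills a slot.\<close>

lemma Hom3_zero:
  assumes "f \<in> Hom3 scale"
  shows "f 0 b c = 0" "f a 0 c = 0" "f a b 0 = 0"
proof -
  have "module_hom scale scale (\<lambda>a. f a b c)" "module_hom scale scale (\<lambda>b. f a b c)"
    "module_hom scale scale (\<lambda>c. f a b c)"
    using assms unfolding Hom3_def by blast+
  from this[THEN module_hom.zero] show "f 0 b c = 0" "f a 0 c = 0" "f a b 0 = 0"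
    by simp_all
qed

text \<open>A cyclic permutation is a product of two transpositions, so the two signs
  cancel.\<close>

lemma Hom3_cyclic:
  assumes "f \<in> Hom3 scale"
  shows "f b c a = f a b c"
proof -
  have "f b c a = - f b a c" "f b a c = - f a b c"
    using assms unfolding Hom3_def by blast+
  then show ?thesis by simp
qed

context modified_differential_three_Lie_algebra
begin

lemmas hom_zero = Hom1_zero[OF d_Hom1] Hom3_zero[OF br_Hom3]

text \<open>Cyclic invariance moves each \<open>g ai\<close> back to slot \<open>i\<close>, the form
  in which these terms arise when a bracket is expanded at order \<open>t\<close>.\<close>

lemma delta1_eq:
  "delta1 br g a1 a2 a3 = br (g a1) a2 a3 + br a1 (g a2) a3 + br a1 a2 (g a3) - g (br a1 a2 a3)"
  using Hom3_cyclic[OF br_Hom3, of a2 a3 "g a1"] Hom3_cyclic[OF br_Hom3, of a1 "g a2" a3]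
  by (simp add: delta1_def)

end

lemma infinitesimal_cocycle:
  fixes scale :: "'k::field_char_0 \<Rightarrow> 'a::ab_group_add \<Rightarrow> 'a"
  assumes "modified_differential_three_Lie_algebra scale br lam d"
    and "linear_deformation scale br lam d nu1 nu2 d1"
  shows "(nu1, d1) \<in> cocycles2 scale br lam d"
proof -
  interpret modified_differential_three_Lie_algebra scale br lam d by fact
  let ?nu = "deformed_bracket scale br nu1 nu2" and ?d = "deformed_map scale d d1"
  have nu1: "nu1 \<in> Hom3 scale" and d1: "d1 \<in> Hom1 scale"
    using assms(2) by (simp_all add: linear_deformation_def)
  interpret t: modified_differential_three_Lie_algebra "fps_scale scale" ?nu "fps_const lam" ?d
    using assms(2) by (simp add: linear_deformation_def)
  have "delta3 br nu1 a1 a2 a3 a4 a5 = 0" for a1 a2 a3 a4 a5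
  proof -
    have "?nu (fps_const a1) (fps_const a2) (?nu (fps_const a3) (fps_const a4) (fps_const a5)) $ Suc 0 =
        (?nu (?nu (fps_const a1) (fps_const a2) (fps_const a3)) (fps_const a4) (fps_const a5) +
         ?nu (fps_const a3) (?nu (fps_const a1) (fps_const a2) (fps_const a4)) (fps_const a5) +
         ?nu (fps_const a3) (fps_const a4) (?nu (fps_const a1) (fps_const a2) (fps_const a5))) $ Suc 0"
      by (subst t.fundamental_identity) simp
    \<comment> \<open>Each nested bracket gives two terms at order \<open>t\<close>:
      \<open>nu1\<close> inside \<open>br\<close> and \<open>br\<close> inside
      \<open>nu1\<close>.\<close>
    then have "br a1 a2 (nu1 a3 a4 a5) + nu1 a1 a2 (br a3 a4 a5) =
        br (nu1 a1 a2 a3) a4 a5 + nu1 (br a1 a2 a3) a4 a5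
        + (br a3 (nu1 a1 a2 a4) a5 + nu1 a3 (br a1 a2 a4) a5)
        + (br a3 a4 (nu1 a1 a2 a5) + nu1 a3 a4 (br a1 a2 a5))"
      by (simp add: deformed_nth hom_zero)
    \<comment> \<open>\<open>delta3\<close> keeps the value of \<open>nu1\<close> in the last slot
      of \<open>br\<close>; two cyclic shifts bring the identity to that form.\<close>
    then show ?thesis
      using Hom3_cyclic[OF br_Hom3, of a4 a5 "nu1 a1 a2 a3"]
        Hom3_cyclic[OF br_Hom3, of a3 "nu1 a1 a2 a4" a5]
      by (simp add: delta3_def algebra_simps)
  qed
  moreover have "delta1 br d1 a1 a2 a3 + Phi3 scale lam d nu1 a1 a2 a3 = 0" for a1 a2 a3
  proof -
    have "?d (?nu (fps_const a1) (fps_const a2) (fps_const a3)) $ Suc 0 =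
        (?nu (?d (fps_const a1)) (fps_const a2) (fps_const a3) +
         ?nu (fps_const a1) (?d (fps_const a2)) (fps_const a3) +
         ?nu (fps_const a1) (fps_const a2) (?d (fps_const a3)) +
         fps_scale scale (fps_const lam) (?nu (fps_const a1) (fps_const a2) (fps_const a3))) $ Suc 0"
      by (subst t.modified_Leibniz) simp
    \<comment> \<open>Since \<open>lam\<close> enters as a constant series, at order
      \<open>t\<close> it only scales \<open>nu1\<close>. Right side minus left side is the cocycle
      expression.\<close>
    then have "d (nu1 a1 a2 a3) + d1 (br a1 a2 a3) =
        br (d1 a1) a2 a3 + nu1 (d a1) a2 a3 + (br a1 (d1 a2) a3 + nu1 a1 (d a2) a3)
        + (br a1 a2 (d1 a3) + nu1 a1 a2 (d a3)) + scale lam (nu1 a1 a2 a3)"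
      by (simp add: deformed_nth hom_zero)
    then show ?thesis
      by (simp add: delta1_eq Phi3_def algebra_simps)
  qed
  ultimately show ?thesis
    using nu1 d1 by (simp add: cocycles2_def fun_eq_iff)
qed

lemma equivalent_infinitesimals_diff:
  fixes scale :: "'k::field_char_0 \<Rightarrow> 'a::ab_group_add \<Rightarrow> 'a"
  assumes "modified_differential_three_Lie_algebra scale br lam d"
    and "equivalent_deformations scale
           (deformed_bracket scale br nu1 nu2) (deformed_map scale d d1)
           (deformed_bracket scale br nu1' nu2') (deformed_map scale d d1')"
  shows "(nu1, d1) - (nu1', d1') \<in> coboundaries2 scale br d"
proof -
  interpret modified_differential_three_Lie_algebra scale br lam d by fact
  let ?nu = "deformed_bracket scale br nu1 nu2" and ?d = "deformed_map scale d d1"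
    and ?nu' = "deformed_bracket scale br nu1' nu2'" and ?d' = "deformed_map scale d d1'"
  obtain N where N: "N \<in> Hom1 scale"
    and Nd: "\<And>a. deformed_map scale id N (?d (fps_const a)) =
      ?d' (deformed_map scale id N (fps_const a))"
    and Nnu: "\<And>a1 a2 a3. deformed_map scale id N (?nu (fps_const a1) (fps_const a2) (fps_const a3)) =
      ?nu' (deformed_map scale id N (fps_const a1)) (deformed_map scale id N (fps_const a2))
        (deformed_map scale id N (fps_const a3))"
    using assms(2) unfolding equivalent_deformations_def Let_def by blast
  have "d1 a - d1' a = - Phi1 d N a" for a
  proof -
    have "d1 a + N (d a) = d (N a) + d1' a"
      using arg_cong[OF Nd[of a], of "\<lambda>x. x $ Suc 0"] by (simp add: deformed_nth hom_zero)
    then show ?thesis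
      by (simp add: Phi1_def algebra_simps)
  qed
  moreover have "nu1 a1 a2 a3 - nu1' a1 a2 a3 = delta1 br N a1 a2 a3" for a1 a2 a3
  proof -
    have "nu1 a1 a2 a3 + N (br a1 a2 a3) =
        br (N a1) a2 a3 + br a1 (N a2) a3 + br a1 a2 (N a3) + nu1' a1 a2 a3"
      using arg_cong[OF Nnu[of a1 a2 a3], of "\<lambda>x. x $ Suc 0"]
      by (simp add: deformed_nth hom_zero)
    then show ?thesis
      by (simp add: delta1_eq algebra_simps)
  qed
  ultimately have "(nu1, d1) - (nu1', d1') = (delta1 br N, - Phi1 d N)"
    by (simp add: fun_eq_iff)
  then show ?thesis
    using N unfolding coboundaries2_def by blast
qed

theorem theorem3p6:
  fixes scale :: "'k::field_char_0 \<Rightarrow> 'a::ab_group_add \<Rightarrow> 'a"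
    and lam :: 'k
    and br nu1 nu2 nu1' nu2' :: "'a \<Rightarrow> 'a \<Rightarrow> 'a \<Rightarrow> 'a"
    and d d1 d1' :: "'a \<Rightarrow> 'a"
  assumes "modified_differential_three_Lie_algebra scale br lam d"
    and "linear_deformation scale br lam d nu1 nu2 d1"
    and "linear_deformation scale br lam d nu1' nu2' d1'"
    and "equivalent_deformations scale
           (deformed_bracket scale br nu1 nu2) (deformed_map scale d d1)
           (deformed_bracket scale br nu1' nu2') (deformed_map scale d d1')"
  shows "\<exists>C \<in> cohomology2 scale br lam d. (nu1, d1) \<in> C \<and> (nu1', d1') \<in> C"
proof -
  interpret modified_differential_three_Lie_algebra scale br lam d by fact
  let ?Z = "cocycles2 scale br lam d" and ?R = "cohomologous2 scale br lam d"
  have Z: "(nu1, d1) \<in> ?Z" "(nu1', d1') \<in> ?Z"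
    using infinitesimal_cocycle assms(1-3) by blast+
  have "((nu1, d1), (nu1', d1')) \<in> ?R"
    using Z equivalent_infinitesimals_diff[OF assms(1,4)] by (simp add: cohomologous2_def)
  moreover have "(nu1, d1) \<in> ?R `` {(nu1, d1)}"
    using equiv_class_self[OF equiv_cohomologous2 Z(1)] .
  ultimately show ?thesis
    using quotientI[OF Z(1)] unfolding cohomology2_def by blast
qed

end
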